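(* Let $G=\mathrm{GIRG}(n,\beta,w_0,d)$ be a standard GIRG with $\beta<3$. Then the clique number satisfies $\omega(G)=O(n^{(3-\beta)/2})$ asymptotically almost surely.
   Context: Fix constants $\lambda>0$, $w_0>0$, $\beta>2$. A standard GIRG $\mathrm{GIRG}(n,\beta,w_0,d)$ has $n$ vertices; each vertex $v$ independently receives a weight $w_v$ with $\Pr[w_v\le x]=1-(x/w_0)^{1-\beta}$ for $x\ge w_0$, and independently a position $\mathbf{x}_v$ uniform on the torus $\mathbb{T}^d=[0,1)^d$. The distance is $d(\mathbf{x}_u,\mathbf{x}_v)=\max_{1\le i\le d}|x_{ui}-x_{vi}|_C$ with $|a-b|_C=\min\{|a-b|,1-|a-b|\}$. Distinct $u,v$ are adjacent iff $d(\mathbf{x}_u,\mathbf{x}_v)\le \frac12\big(\frac{\lambda w_uw_v}{n}\big)^{1/d}$. The dimension $d=d(n)$ may depend on $n$. $\omega(G)$ is the size of the largest clique; "asymptotically almost surely" means with probability $1-o(1)$ as $n\to\infty$. *)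

theory Defs
  imports "HOL-Probability.Probability" "HOL-Library.Ramsey"
begin

definition weight_cdf :: "real \<Rightarrow> real \<Rightarrow> real \<Rightarrow> real" where
  "weight_cdf \<beta> w0 x = (if x < w0 then 0 else 1 - (x / w0) powr (1 - \<beta>))"

text \<open>The Lebesgue--Stieltjes measure of the distribution function, i.e. the law of a single weight
  (see \<open>cdf_weight_distribution\<close> below).\<close>

definition weight_distribution :: "real \<Rightarrow> real \<Rightarrow> real measure" where
  "weight_distribution \<beta> w0 = interval_measure (weight_cdf \<beta> w0)"

text \<open>Points of the torus are functions on the coordinate set \<open>{..<d}\<close>; the uniform law on
  \<open>[0,1)\<^sup>d\<close> is the \<open>d\<close>-fold product of the uniform law on \<open>[0,1)\<close>.\<close>

definition torus_uniform :: "nat \<Rightarrow> (nat \<Rightarrow> real) measure" where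
  "torus_uniform d = PiM {..<d} (\<lambda>_. uniform_measure lborel {0..<1})"

text \<open>Outcomes are pairs \<open>(w, x)\<close>, where \<open>w v\<close> is the weight of vertex \<open>v < n\<close> and \<open>x v\<close> its position.
  The product measure makes all weights and positions independent. The graph itself is a function of
  the outcome, see \<open>girg_edges\<close>.\<close>

definition girg_measure :: "nat \<Rightarrow> real \<Rightarrow> real \<Rightarrow> nat \<Rightarrow> ((nat \<Rightarrow> real) \<times> (nat \<Rightarrow> nat \<Rightarrow> real)) measure" where
  "girg_measure n \<beta> w0 d =
     PiM {..<n} (\<lambda>_. weight_distribution \<beta> w0) \<Otimes>\<^sub>M PiM {..<n} (\<lambda>_. torus_uniform d)"

definition circle_dist :: "real \<Rightarrow> real \<Rightarrow> real" where
  "circle_dist a b = min \<bar>a - b\<bar> (1 - \<bar>a - b\<bar>)"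

text \<open>Only meaningful for \<open>d \<ge> 1\<close>.\<close>

definition torus_dist :: "nat \<Rightarrow> (nat \<Rightarrow> real) \<Rightarrow> (nat \<Rightarrow> real) \<Rightarrow> real" where
  "torus_dist d x y = Max ((\<lambda>i. circle_dist (x i) (y i)) ` {..<d})"

definition girg_edges ::
    "real \<Rightarrow> nat \<Rightarrow> nat \<Rightarrow> (nat \<Rightarrow> real) \<times> (nat \<Rightarrow> nat \<Rightarrow> real) \<Rightarrow> nat set set" where
  "girg_edges lam n d = (\<lambda>(w, x).
     {{u, v} | u v. u < n \<and> v < n \<and> u \<noteq> v \<and>
        torus_dist d (x u) (x v) \<le> 1 / 2 * (lam * w u * w v / real n) powr (1 / real d)})"

definition clique_number :: "'a set \<Rightarrow> 'a set set \<Rightarrow> nat" where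
  "clique_number V E = Max {card K | K. K \<subseteq> V \<and> clique K E}"

lemma weight_cdf_eq:
  assumes "w0 > 0"
  shows "weight_cdf \<beta> w0 x = 1 - (max x w0 / w0) powr (1 - \<beta>)"
  using assms by (auto simp: weight_cdf_def max_def)

lemma weight_cdf_mono:
  assumes "w0 > 0" "\<beta> > 1" "x \<le> y"
  shows "weight_cdf \<beta> w0 x \<le> weight_cdf \<beta> w0 y"
  unfolding weight_cdf_eq[OF assms(1)] using assms
  by (intro diff_left_mono powr_mono2') (auto simp: divide_simps)

lemma weight_cdf_right_cont:
  assumes "w0 > 0"
  shows "continuous (at_right a) (weight_cdf \<beta> w0)"
proof -
  have "isCont (\<lambda>x. 1 - (max x w0 / w0) powr (1 - \<beta>)) a"
    using assms by (intro continuous_intros) auto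
  moreover have "weight_cdf \<beta> w0 = (\<lambda>x. 1 - (max x w0 / w0) powr (1 - \<beta>))"
    using weight_cdf_eq[OF assms] by blast
  ultimately show ?thesis
    by (simp add: continuous_at_imp_continuous_within)
qed

lemma weight_cdf_at_bot: "(weight_cdf \<beta> w0 \<longlongrightarrow> 0) at_bot"
proof (rule tendsto_eventually)
  show "\<forall>\<^sub>F x in at_bot. weight_cdf \<beta> w0 x = 0"
    using eventually_gt_at_bot[of w0] eventually_at_bot_dense[of "\<lambda>x. weight_cdf \<beta> w0 x = 0"]
    by (auto simp: weight_cdf_def)
qed

lemma weight_cdf_at_top:
  assumes "w0 > 0" "\<beta> > 1"
  shows "(weight_cdf \<beta> w0 \<longlongrightarrow> 1) at_top"
proof -
  have "filterlim (\<lambda>x. x / w0) at_top at_top"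
    unfolding filterlim_at_top
  proof
    fix Z
    show "\<forall>\<^sub>F x in at_top. Z \<le> x / w0"
      using eventually_ge_at_top[of "Z * w0"]
      by eventually_elim (use assms in \<open>simp add: field_simps\<close>)
  qed
  then have "((\<lambda>x. (x / w0) powr (1 - \<beta>)) \<longlongrightarrow> 0) at_top"
    using assms by (intro tendsto_neg_powr) auto
  then have "((\<lambda>x. 1 - (x / w0) powr (1 - \<beta>)) \<longlongrightarrow> 1 - 0) at_top"
    by (intro tendsto_intros)
  moreover have "\<forall>\<^sub>F x in at_top. 1 - (x / w0) powr (1 - \<beta>) = weight_cdf \<beta> w0 x"
    using eventually_ge_at_top[of w0] by eventually_elim (auto simp: weight_cdf_def)
  ultimately show ?thesis
    by (simp add: filterlim_cong[OF refl refl])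
qed

lemma real_distribution_weight_distribution:
  assumes "w0 > 0" "\<beta> > 1"
  shows "real_distribution (weight_distribution \<beta> w0)"
  unfolding weight_distribution_def
  using assms
  by (intro real_distribution_interval_measure weight_cdf_mono weight_cdf_right_cont
        weight_cdf_at_bot weight_cdf_at_top)

lemma cdf_weight_distribution:
  assumes "w0 > 0" "\<beta> > 1"
  shows "cdf (weight_distribution \<beta> w0) = weight_cdf \<beta> w0"
  unfolding weight_distribution_def
  using assms
  by (intro cdf_interval_measure weight_cdf_mono weight_cdf_right_cont weight_cdf_at_bot)

lemma prob_space_torus_uniform: "prob_space (torus_uniform d)"
  unfolding torus_uniform_def
  by (intro prob_space_PiM prob_space_uniform_measure) auto

lemma prob_space_girg_measure:
  assumes "w0 > 0" "\<beta> > 1"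
  shows "prob_space (girg_measure n \<beta> w0 d)"
proof -
  interpret W: prob_space "PiM {..<n} (\<lambda>_. weight_distribution \<beta> w0)"
    using real_distribution_weight_distribution[OF assms]
    by (intro prob_space_PiM) (simp add: real_distribution_def)
  interpret X: prob_space "PiM {..<n} (\<lambda>_. torus_uniform d)"
    by (intro prob_space_PiM prob_space_torus_uniform)
  interpret pair_prob_space "PiM {..<n} (\<lambda>_. weight_distribution \<beta> w0)"
      "PiM {..<n} (\<lambda>_. torus_uniform d)" ..
  show ?thesis
    unfolding girg_measure_def by (rule prob_space_axioms)
qed

end

theory Submission
  imports Defs "HOL-Real_Asymp.Real_Asymp"
begin

text \<open>In a clique with more than \<open>k\<close> vertices, a vertex \<open>u\<close> of minimal weight is adjacent to
  \<open>k\<close> vertices of at least its own weight. Given the weight and position of \<open>u\<close>, these \<open>k\<close>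
  adjacencies are independent. Put \<open>s = (\<beta> - 1) / 2\<close>, which is at most 1. In every dimension two
  vertices of weights \<open>a\<close> and \<open>b\<close> are adjacent with probability at most
  \<open>min 1 (\<lambda> a b / n) \<le> (\<lambda> a b / n) powr s\<close>, and integrating this over the weights \<open>b \<ge> a\<close> gives
  \<open>q = 2 (\<lambda> w0\<^sup>2 / n) powr s\<close>: for this exponent the powers of \<open>a\<close> cancel. A union bound over
  \<open>u\<close> and the \<open>k\<close> neighbours gives at most \<open>n (n choose k) q ^ k \<le> n exp (e n q - k)\<close>, which
  tends to 0 when \<open>k\<close> is a large enough multiple of \<open>n powr ((3 - \<beta>) / 2)\<close>.\<close>

subsection \<open>Stars in product spaces\<close>

lemma emeasure_Collect_eq_nn_integral:
  assumes "Measurable.pred M P"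
  shows "emeasure M {x \<in> space M. P x} = (\<integral>\<^sup>+x. (if P x then 1 else 0) \<partial>M)"
proof -
  have "(\<integral>\<^sup>+x. (if P x then 1 else 0) \<partial>M) = (\<integral>\<^sup>+x. indicator {x \<in> space M. P x} x \<partial>M)"
    by (intro nn_integral_cong) (auto simp: indicator_def)
  then show ?thesis
    using assms by (simp add: pred_def)
qed

lemma measurable_PiM_component_pair:
  assumes "u \<in> I" "v \<in> I" and "case_prod g \<in> measurable (M u \<Otimes>\<^sub>M M v) N"
  shows "(\<lambda>x. g (x u) (x v)) \<in> measurable (PiM I M) N"
proof -
  have "(\<lambda>x. (x u, x v)) \<in> measurable (PiM I M) (M u \<Otimes>\<^sub>M M v)"
    using assms by (intro measurable_Pair measurable_component_singleton)
  from measurable_compose[OF this assms(3)] show ?thesis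
    by simp
qed

lemma (in product_prob_space) nn_integral_PiM_prod_subset:
  fixes f :: "'i \<Rightarrow> 'a \<Rightarrow> ennreal"
  assumes "finite J" "S \<subseteq> J" and "\<And>v. v \<in> S \<Longrightarrow> f v \<in> borel_measurable (M v)"
  shows "(\<integral>\<^sup>+x. (\<Prod>v\<in>S. f v (x v)) \<partial>PiM J M) = (\<Prod>v\<in>S. \<integral>\<^sup>+b. f v b \<partial>M v)"
proof -
  define g where "g v = (if v \<in> S then f v else (\<lambda>_. 1))" for v
  have "(\<integral>\<^sup>+x. (\<Prod>v\<in>S. f v (x v)) \<partial>PiM J M) = (\<integral>\<^sup>+x. (\<Prod>v\<in>J. g v (x v)) \<partial>PiM J M)"
    unfolding g_def using assms by (intro nn_integral_cong prod.mono_neutral_cong_left) auto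
  also have "\<dots> = (\<Prod>v\<in>J. \<integral>\<^sup>+b. g v b \<partial>M v)"
    using assms by (intro product_nn_integral_prod) (auto simp: g_def)
  also have "\<dots> = (\<Prod>v\<in>S. \<integral>\<^sup>+b. f v b \<partial>M v)"
    unfolding g_def using assms
    by (intro prod.mono_neutral_cong_right) (auto simp: M.emeasure_space_1)
  finally show ?thesis .
qed

text \<open>Conditioning on coordinate \<open>u\<close> makes the factors independent.\<close>

lemma (in product_prob_space) nn_integral_PiM_star_le:
  fixes f :: "'i \<Rightarrow> 'a \<Rightarrow> 'a \<Rightarrow> ennreal"
  assumes star: "finite I" "u \<in> I" "S \<subseteq> I - {u}"
    and f_measurable: "\<And>v. v \<in> S \<Longrightarrow> case_prod (f v) \<in> borel_measurable (M u \<Otimes>\<^sub>M M v)"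
    and f_le: "AE a in M u. \<forall>v\<in>S. (\<integral>\<^sup>+b. f v a b \<partial>M v) \<le> c v"
  shows "(\<integral>\<^sup>+x. (\<Prod>v\<in>S. f v (x u) (x v)) \<partial>PiM I M) \<le> (\<Prod>v\<in>S. c v)"
proof -
  define J where "J = I - {u}"
  have J: "finite J" "u \<notin> J" "S \<subseteq> J" "I = insert u J"
    using star by (auto simp: J_def)
  have prod_measurable: "(\<lambda>x. \<Prod>v\<in>S. f v (x u) (x v)) \<in> borel_measurable (PiM (insert u J) M)"
    using J f_measurable by (intro borel_measurable_prod_ennreal measurable_PiM_component_pair) auto
  have conditional: "(\<integral>\<^sup>+x. (\<Prod>v\<in>S. f v ((x(u := a)) u) ((x(u := a)) v)) \<partial>PiM J M) =
      (\<Prod>v\<in>S. \<integral>\<^sup>+b. f v a b \<partial>M v)" if a: "a \<in> space (M u)" for a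
  proof -
    have "(\<Prod>v\<in>S. f v ((x(u := a)) u) ((x(u := a)) v)) = (\<Prod>v\<in>S. f v a (x v))" for x
      using J by (intro prod.cong) auto
    moreover have "f v a \<in> borel_measurable (M v)" if "v \<in> S" for v
      using measurable_Pair2[OF f_measurable[OF that] a] by simp
    ultimately show ?thesis
      using nn_integral_PiM_prod_subset[of J S "\<lambda>v. f v a"] J by simp
  qed
  have "(\<integral>\<^sup>+x. (\<Prod>v\<in>S. f v (x u) (x v)) \<partial>PiM I M) = (\<integral>\<^sup>+a. (\<Prod>v\<in>S. \<integral>\<^sup>+b. f v a b \<partial>M v) \<partial>M u)"
    unfolding J(4) product_nn_integral_insert_rev[OF J(1,2) prod_measurable]
    by (intro nn_integral_cong conditional)
  also have "\<dots> \<le> (\<integral>\<^sup>+a. (\<Prod>v\<in>S. c v) \<partial>M u)"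
    using f_le
    by (intro nn_integral_mono_AE) (auto elim!: eventually_mono intro!: prod_mono_ennreal)
  also have "\<dots> = (\<Prod>v\<in>S. c v)"
    by (simp add: M.emeasure_space_1)
  finally show ?thesis .
qed

lemma (in product_prob_space) emeasure_PiM_star_le:
  assumes star: "finite I" "u \<in> I" "S \<subseteq> I - {u}"
    and R_measurable: "\<And>v. v \<in> S \<Longrightarrow> Measurable.pred (M u \<Otimes>\<^sub>M M v) (\<lambda>(a, b). R v a b)"
    and R_le: "AE a in M u. \<forall>v\<in>S. emeasure (M v) {b \<in> space (M v). R v a b} \<le> c v"
  shows "emeasure (PiM I M) {x \<in> space (PiM I M). \<forall>v\<in>S. R v (x u) (x v)} \<le> (\<Prod>v\<in>S. c v)"
proof -
  define f :: "'i \<Rightarrow> 'a \<Rightarrow> 'a \<Rightarrow> ennreal" where "f v a b = (if R v a b then 1 else 0)" for v a b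
  have fin: "finite S"
    using star finite_subset by blast
  have "Measurable.pred (PiM I M) (\<lambda>x. \<forall>v\<in>S. R v (x u) (x v))"
    using star R_measurable by (intro pred_intros_finite fin measurable_PiM_component_pair) auto
  then have "emeasure (PiM I M) {x \<in> space (PiM I M). \<forall>v\<in>S. R v (x u) (x v)} =
      (\<integral>\<^sup>+x. (if \<forall>v\<in>S. R v (x u) (x v) then 1 else 0) \<partial>PiM I M)"
    by (rule emeasure_Collect_eq_nn_integral)
  also have "\<dots> = (\<integral>\<^sup>+x. (\<Prod>v\<in>S. f v (x u) (x v)) \<partial>PiM I M)"
    using fin by (intro nn_integral_cong) (auto simp: f_def)
  also have "\<dots> \<le> (\<Prod>v\<in>S. c v)"
  proof (rule nn_integral_PiM_star_le[OF star])
    show "case_prod (f v) \<in> borel_measurable (M u \<Otimes>\<^sub>M M v)" if "v \<in> S" for v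
      using R_measurable[OF that] unfolding f_def case_prod_beta' by measurable
    show "AE a in M u. \<forall>v\<in>S. (\<integral>\<^sup>+b. f v a b \<partial>M v) \<le> c v"
      using R_le AE_space
    proof eventually_elim
      case (elim a)
      show ?case
      proof
        fix v assume v: "v \<in> S"
        have "Measurable.pred (M v) (R v a)"
          using measurable_Pair2[OF R_measurable[OF v] elim(2)] by simp
        then show "(\<integral>\<^sup>+b. f v a b \<partial>M v) \<le> c v"
          using elim(1) v by (simp add: f_def flip: emeasure_Collect_eq_nn_integral)
      qed
    qed
  qed
  finally show ?thesis .
qed

subsection \<open>Balls in the torus\<close>

lemma circle_dist_commute: "circle_dist a b = circle_dist b a"
  by (simp add: circle_dist_def abs_minus_commute)

lemma torus_dist_commute: "torus_dist d x y = torus_dist d y x"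
  by (simp add: torus_dist_def circle_dist_commute)

lemma torus_dist_le_iff:
  assumes "d \<ge> 1"
  shows "torus_dist d x y \<le> r \<longleftrightarrow> (\<forall>i<d. circle_dist (x i) (y i) \<le> r)"
proof -
  have "{..<d} \<noteq> {}"
    using assms by (auto simp: lessThan_empty_iff)
  then show ?thesis
    unfolding torus_dist_def by (subst Max_le_iff) auto
qed

lemma sets_torus_uniform [measurable_cong]:
  "sets (torus_uniform d) = sets (PiM {..<d} (\<lambda>_. borel))"
  unfolding torus_uniform_def by (intro sets_PiM_cong) auto

lemma measurable_circle_dist [measurable]:
  assumes [measurable]: "f \<in> borel_measurable M" "g \<in> borel_measurable M"
  shows "(\<lambda>x. circle_dist (f x) (g x)) \<in> borel_measurable M"
  unfolding circle_dist_def by measurable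

lemma measurable_torus_dist:
  assumes "f \<in> measurable M (torus_uniform d)" "g \<in> measurable M (torus_uniform d)"
  shows "(\<lambda>x. torus_dist d (f x) (g x)) \<in> borel_measurable M"
proof -
  have "(\<lambda>x. h x i) \<in> borel_measurable M" if "h \<in> measurable M (torus_uniform d)" "i < d" for h i
    using measurable_compose[OF that(1), of "\<lambda>x. x i" borel] that(2)
    by (simp add: sets_torus_uniform cong: measurable_cong_sets)
  then show ?thesis
    unfolding torus_dist_def
    using assms by (intro borel_measurable_Max measurable_circle_dist) auto
qed

lemma emeasure_circle_ball_le:
  assumes "0 \<le> a" "a < 1" "0 \<le> r"
  shows "emeasure (uniform_measure lborel {0..<1}) {b. circle_dist a b \<le> r} \<le> ennreal (2 * r)"
proof (cases "2 * r \<ge> 1")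
  case True
  interpret prob_space "uniform_measure lborel {0..<1::real}"
    by (rule prob_space_uniform_measure) auto
  show ?thesis
    using order_trans[OF emeasure_le_1] True by (metis ennreal_1 ennreal_leI)
next
  case False
  let ?middle = "{max 0 (a - r)..min 1 (a + r)}" and ?right = "{a + 1 - r..1}"
    and ?left = "{0..a - 1 + r}"
  have [measurable]: "{b. circle_dist a b \<le> r} \<in> sets borel"
    by measurable
  have "emeasure (uniform_measure lborel {0..<1}) {b. circle_dist a b \<le> r} =
      emeasure lborel ({0..<1} \<inter> {b. circle_dist a b \<le> r})"
    by (simp add: divide_ennreal_def)
  also have "\<dots> \<le> emeasure lborel (?middle \<union> (?right \<union> ?left))"
    using assms
    by (intro emeasure_mono) (auto simp: circle_dist_def min_def max_def abs_if split: if_splits)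
  also have "\<dots> \<le> emeasure lborel ?middle + (emeasure lborel ?right + emeasure lborel ?left)"
    by (intro order_trans[OF emeasure_subadditive] add_left_mono) auto
  also have "\<dots> = ennreal (2 * r)"
    using assms False
    by (auto simp: emeasure_lborel_Icc_eq min_def max_def simp flip: ennreal_plus)
  finally show ?thesis .
qed

lemma AE_torus_uniform: "AE x in torus_uniform d. \<forall>i<d. x i \<in> {0..<1}"
proof -
  have "AE x in torus_uniform d. \<forall>i\<in>{..<d}. x i \<in> {0..<1}"
    unfolding torus_uniform_def
  proof (intro AE_finite_allI AE_PiM_component)
    show "AE x in uniform_measure lborel {0..<1::real}. x \<in> {0..<1}"
      by (rule AE_uniform_measureI) auto
  qed (auto intro: prob_space_uniform_measure)
  then show ?thesis
    by (simp add: Ball_def)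
qed

lemma emeasure_torus_ball_le:
  assumes d: "d \<ge> 1" and a: "\<forall>i<d. a i \<in> {0..<1}" and r: "r \<ge> 0"
  shows "emeasure (torus_uniform d) {b \<in> space (torus_uniform d). torus_dist d a b \<le> r}
    \<le> ennreal ((2 * r) ^ d)"
proof -
  let ?U = "uniform_measure lborel {0..<1::real}"
  interpret product_prob_space "\<lambda>_. ?U" "{..<d}"
    by (intro product_prob_spaceI prob_space_uniform_measure) auto
  have "{b \<in> space (torus_uniform d). torus_dist d a b \<le> r} =
      PiE {..<d} (\<lambda>i. {b. circle_dist (a i) b \<le> r})"
    unfolding torus_dist_le_iff[OF d]
    by (rule set_eqI) (simp add: torus_uniform_def space_PiM PiE_iff Ball_def conj_commute)
  also have "emeasure (torus_uniform d) \<dots> = (\<Prod>i<d. emeasure ?U {b. circle_dist (a i) b \<le> r})"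
    unfolding torus_uniform_def by (rule emeasure_PiM) (simp_all, measurable)
  also have "\<dots> \<le> (\<Prod>i<d. ennreal (2 * r))"
    using a r by (intro prod_mono_ennreal emeasure_circle_ball_le) auto
  also have "\<dots> = ennreal ((2 * r) ^ d)"
    using r by (simp add: ennreal_power)
  finally show ?thesis .
qed

lemma emeasure_torus_ball_of_volume_le:
  assumes "d \<ge> 1" "\<forall>i<d. a i \<in> {0..<1}" "t \<ge> 0"
  shows "emeasure (torus_uniform d)
      {b \<in> space (torus_uniform d). torus_dist d a b \<le> 1 / 2 * t powr (1 / real d)}
    \<le> ennreal (min 1 t)"
proof -
  interpret prob_space "torus_uniform d"
    by (rule prob_space_torus_uniform)
  have "(2 * (1 / 2 * t powr (1 / real d))) ^ d = t"
    using assms by (cases "t = 0") (auto simp: powr_powr simp flip: powr_realpow)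
  then show ?thesis
    using emeasure_torus_ball_le[OF assms(1,2), of "1 / 2 * t powr (1 / real d)"]
      emeasure_le_1 by (auto simp: min_def)
qed

subsection \<open>The weight distribution\<close>

lemma sets_weight_distribution [simp, measurable_cong]:
  "sets (weight_distribution \<beta> w0) = sets borel"
  by (simp add: weight_distribution_def)

lemma nn_integral_powr_atLeast:
  fixes a q :: real
  assumes "q > 0" "a > 0"
  shows "(\<integral>\<^sup>+x\<in>{a..}. ennreal (x powr (- q - 1)) \<partial>lborel) = ennreal (a powr - q / q)"
  using assms has_integral_powr_to_inf[of "- q - 1" a]
  by (intro nn_integral_has_integral_lebesgue') auto

definition weight_density :: "real \<Rightarrow> real \<Rightarrow> real \<Rightarrow> real" where
  "weight_density \<beta> w0 x = (if x \<le> w0 then 0 else (\<beta> - 1) * w0 powr (\<beta> - 1) * x powr (-\<beta>))"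

lemma measurable_weight_density [measurable]: "weight_density \<beta> w0 \<in> borel_measurable borel"
  unfolding weight_density_def by measurable

lemma emeasure_weight_distribution_greaterThan:
  assumes "w0 > 0" "\<beta> > 1"
  shows "emeasure (weight_distribution \<beta> w0) {x<..} = ennreal ((max x w0 / w0) powr (1 - \<beta>))"
proof -
  interpret real_distribution "weight_distribution \<beta> w0"
    using assms by (rule real_distribution_weight_distribution)
  have "prob {x<..} = 1 - cdf (weight_distribution \<beta> w0) x"
    using prob_compl[of "{..x}"] by (simp add: cdf_def Compl_eq_Diff_UNIV[symmetric])
  then show ?thesis
    using assms by (simp add: emeasure_eq_measure cdf_weight_distribution weight_cdf_eq)
qed

lemma emeasure_weight_density_greaterThan:
  assumes "w0 > 0" "\<beta> > 1"
  shows "emeasure (density lborel (weight_density \<beta> w0)) {x<..} =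
    ennreal ((max x w0 / w0) powr (1 - \<beta>))"
proof -
  define m where "m = max x w0"
  have m_pos: "m > 0"
    using assms by (simp add: m_def)
  have "emeasure (density lborel (weight_density \<beta> w0)) {x<..} =
      (\<integral>\<^sup>+y\<in>{x<..}. ennreal (weight_density \<beta> w0 y) \<partial>lborel)"
    by (simp add: emeasure_density)
  also have "\<dots> = (\<integral>\<^sup>+y. ennreal ((\<beta> - 1) * w0 powr (\<beta> - 1)) *
      (ennreal (y powr (-\<beta>)) * indicator {m..} y) \<partial>lborel)"
  proof (rule nn_integral_cong_AE)
    show "AE y in lborel. ennreal (weight_density \<beta> w0 y) * indicator {x<..} y =
        ennreal ((\<beta> - 1) * w0 powr (\<beta> - 1)) * (ennreal (y powr (-\<beta>)) * indicator {m..} y)"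
      using AE_lborel_singleton[of m]
      by eventually_elim
        (use assms in \<open>auto simp: weight_density_def m_def ennreal_mult split: split_indicator\<close>)
  qed
  also have "\<dots> = ennreal ((\<beta> - 1) * w0 powr (\<beta> - 1)) *
      (\<integral>\<^sup>+y\<in>{m..}. ennreal (y powr (-\<beta>)) \<partial>lborel)"
    by (intro nn_integral_cmult) measurable
  also have "\<dots> = ennreal ((\<beta> - 1) * w0 powr (\<beta> - 1)) * ennreal (m powr (1 - \<beta>) / (\<beta> - 1))"
    using assms m_pos nn_integral_powr_atLeast[of "\<beta> - 1" m] by simp
  also have "\<dots> = ennreal (m powr (1 - \<beta>) * w0 powr (\<beta> - 1))"
    using assms by (simp flip: ennreal_mult)
  also have "m powr (1 - \<beta>) * w0 powr (\<beta> - 1) = (m / w0) powr (1 - \<beta>)"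
    using powr_minus_divide[of w0 "1 - \<beta>"] by (simp add: powr_divide)
  finally show ?thesis
    by (simp add: m_def)
qed

lemma weight_distribution_eq_density:
  assumes "w0 > 0" "\<beta> > 1"
  shows "weight_distribution \<beta> w0 = density lborel (weight_density \<beta> w0)"
  using assms
  by (intro measure_eqI_lessThan)
    (auto simp: emeasure_weight_distribution_greaterThan emeasure_weight_density_greaterThan)

lemma AE_weight_greater:
  assumes "w0 > 0" "\<beta> > 1"
  shows "AE a in weight_distribution \<beta> w0. a > w0"
  unfolding weight_distribution_eq_density[OF assms]
  by (subst AE_density) (auto simp: weight_density_def)

lemma nn_integral_weight_powr_le:
  assumes "w0 > 0" "\<beta> > 1" "a > 0" "s < \<beta> - 1"
  shows "(\<integral>\<^sup>+b\<in>{a..}. ennreal (b powr s) \<partial>weight_distribution \<beta> w0)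
    \<le> ennreal ((\<beta> - 1) / (\<beta> - 1 - s) * w0 powr (\<beta> - 1) * a powr (s + 1 - \<beta>))"
proof -
  let ?K = "(\<beta> - 1) * w0 powr (\<beta> - 1)"
  have "(\<integral>\<^sup>+b\<in>{a..}. ennreal (b powr s) \<partial>weight_distribution \<beta> w0) =
      (\<integral>\<^sup>+b. ennreal (weight_density \<beta> w0 b) * (ennreal (b powr s) * indicator {a..} b) \<partial>lborel)"
    unfolding weight_distribution_eq_density[OF assms(1,2)]
    by (intro nn_integral_density) measurable
  also have "\<dots> \<le> (\<integral>\<^sup>+b. ennreal ?K * (ennreal (b powr (s - \<beta>)) * indicator {a..} b) \<partial>lborel)"
    using assms
    by (intro nn_integral_mono)
      (auto simp: weight_density_def powr_diff powr_minus_divide simp flip: ennreal_mult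
        split: split_indicator)
  also have "\<dots> = ennreal ?K * (\<integral>\<^sup>+b\<in>{a..}. ennreal (b powr (s - \<beta>)) \<partial>lborel)"
    by (intro nn_integral_cmult) measurable
  also have "(\<integral>\<^sup>+b\<in>{a..}. ennreal (b powr (s - \<beta>)) \<partial>lborel) =
      ennreal (a powr (s + 1 - \<beta>) / (\<beta> - 1 - s))"
    using assms nn_integral_powr_atLeast[of "\<beta> - 1 - s" a] by (simp add: algebra_simps)
  also have "ennreal ?K * ennreal (a powr (s + 1 - \<beta>) / (\<beta> - 1 - s)) =
      ennreal ((\<beta> - 1) / (\<beta> - 1 - s) * w0 powr (\<beta> - 1) * a powr (s + 1 - \<beta>))"
    using assms by (subst ennreal_mult[symmetric]) auto
  finally show ?thesis .
qed

lemma min_one_le_powr: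
  fixes x s :: real
  assumes "x \<ge> 0" "0 \<le> s" "s \<le> 1"
  shows "min 1 x \<le> x powr s"
proof (cases "x \<le> 1")
  case True
  then show ?thesis
    using assms powr_mono'[of s 1 x] by simp
next
  case False
  then show ?thesis
    using assms ge_one_powr_ge_zero[of x s] by simp
qed

lemma nn_integral_weight_min_one_le:
  assumes "w0 > 0" "1 < \<beta>" "\<beta> \<le> 3" "a > 0" "c \<ge> 0"
  shows "(\<integral>\<^sup>+b\<in>{a..}. ennreal (min 1 (c * a * b)) \<partial>weight_distribution \<beta> w0)
    \<le> ennreal (2 * (c * w0\<^sup>2) powr ((\<beta> - 1) / 2))"
proof -
  define s where "s = (\<beta> - 1) / 2"
  have s: "0 < s" "s \<le> 1" "\<beta> - 1 = 2 * s" "s + 1 - \<beta> = - s"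
    using assms by (auto simp: s_def field_simps)
  have "(\<integral>\<^sup>+b\<in>{a..}. ennreal (min 1 (c * a * b)) \<partial>weight_distribution \<beta> w0)
      \<le> (\<integral>\<^sup>+b. ennreal ((c * a) powr s) * (ennreal (b powr s) * indicator {a..} b)
          \<partial>weight_distribution \<beta> w0)"
  proof (intro nn_integral_mono)
    fix b
    have "min 1 (c * a * b) \<le> (c * a) powr s * b powr s" if "b \<ge> a"
      using min_one_le_powr[of "c * a * b" s] that assms s by (simp add: powr_mult)
    then show "ennreal (min 1 (c * a * b)) * indicator {a..} b
        \<le> ennreal ((c * a) powr s) * (ennreal (b powr s) * indicator {a..} b)"
      by (auto simp flip: ennreal_mult intro: ennreal_leI split: split_indicator)
  qed
  also have "\<dots> = ennreal ((c * a) powr s) *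
      (\<integral>\<^sup>+b\<in>{a..}. ennreal (b powr s) \<partial>weight_distribution \<beta> w0)"
    by (intro nn_integral_cmult) measurable
  also have "\<dots> \<le> ennreal ((c * a) powr s) *
      ennreal ((\<beta> - 1) / (\<beta> - 1 - s) * w0 powr (\<beta> - 1) * a powr (s + 1 - \<beta>))"
    using assms s by (intro mult_left_mono nn_integral_weight_powr_le) auto
  also have "\<dots> = ennreal ((c * a) powr s * (2 * w0 powr (2 * s) * a powr - s))"
    unfolding s(3,4) using s(1) by (simp flip: ennreal_mult)
  also have "(c * a) powr s * (2 * w0 powr (2 * s) * a powr - s) = 2 * (c * w0\<^sup>2) powr s"
    using assms by (simp add: powr_mult powr_minus powr_powr flip: powr_numeral)
  finally show ?thesis
    by (simp add: s_def)
qed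

subsection \<open>Cliques and stars in random graphs\<close>

lemma doubleton_in_girg_edges_iff:
  "{u, v} \<in> girg_edges lam n d (w, x) \<longleftrightarrow>
     u < n \<and> v < n \<and> u \<noteq> v \<and>
     torus_dist d (x u) (x v) \<le> 1 / 2 * (lam * w u * w v / real n) powr (1 / real d)"
  unfolding girg_edges_def
  by (auto simp: doubleton_eq_iff torus_dist_commute mult_ac)

lemma clique_number_le_iff:
  assumes "finite V"
  shows "clique_number V E \<le> k \<longleftrightarrow> (\<forall>K\<in>Pow V. clique K E \<longrightarrow> card K \<le> k)"
proof -
  let ?A = "{card K | K. K \<subseteq> V \<and> clique K E}"
  have "?A = card ` {K \<in> Pow V. clique K E}"
    by blast
  then have "finite ?A"
    using assms by simp
  moreover have "card {} \<in> ?A"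
    by (force simp: clique_def)
  then have "?A \<noteq> {}"
    by blast
  ultimately show ?thesis
    unfolding clique_number_def by (subst Max_le_iff) auto
qed

locale girg =
  fixes lam w0 \<beta> :: real and n d :: nat
  assumes lam_pos: "lam > 0" and w0_pos: "w0 > 0" and \<beta>_bounds: "1 < \<beta>" "\<beta> \<le> 3"
    and d_pos: "d \<ge> 1"
begin

abbreviation "\<W> \<equiv> weight_distribution \<beta> w0"
abbreviation "\<T> \<equiv> torus_uniform d"
abbreviation "\<G> \<equiv> girg_measure n \<beta> w0 d"
abbreviation "edges \<equiv> girg_edges lam n d"

sublocale prob_space \<G>
  using w0_pos \<beta>_bounds by (intro prob_space_girg_measure)

lemma product_prob_space_weights: "product_prob_space (\<lambda>_. \<W>)"
  using real_distribution_weight_distribution[OF w0_pos \<beta>_bounds(1)]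
  by (intro product_prob_spaceI) (simp add: real_distribution_def)

lemma product_prob_space_positions: "product_prob_space (\<lambda>_. \<T>)"
  by (intro product_prob_spaceI prob_space_torus_uniform)

definition close :: "(nat \<Rightarrow> real) \<times> (nat \<Rightarrow> nat \<Rightarrow> real) \<Rightarrow> nat \<Rightarrow> nat \<Rightarrow> bool" where
  "close G u v \<longleftrightarrow>
     torus_dist d (snd G u) (snd G v)
       \<le> 1 / 2 * (lam * fst G u * fst G v / real n) powr (1 / real d)"

definition upward_star :: "(nat \<Rightarrow> real) \<times> (nat \<Rightarrow> nat \<Rightarrow> real) \<Rightarrow> nat \<Rightarrow> nat set \<Rightarrow> bool" where
  "upward_star G u S \<longleftrightarrow> (\<forall>v\<in>S. fst G u \<le> fst G v \<and> close G u v)"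

lemma edge_iff_close:
  "{u, v} \<in> edges G \<longleftrightarrow> u < n \<and> v < n \<and> u \<noteq> v \<and> close G u v"
  by (cases G) (simp add: doubleton_in_girg_edges_iff close_def)

lemma clique_imp_upward_star:
  assumes clique: "K \<subseteq> {..<n}" "clique K (edges G)" "card K > k"
  obtains u S where "u < n" "S \<subseteq> {..<n} - {u}" "card S = k" "upward_star G u S"
proof -
  have K: "finite K" "K \<noteq> {}"
    using clique finite_subset by fastforce+
  then obtain u where u: "u \<in> K" "\<And>v. v \<in> K \<Longrightarrow> fst G u \<le> fst G v"
    by (metis arg_min_if_finite(1) arg_min_least)
  have "k \<le> card (K - {u})"
    using clique(3) u K by simp
  then obtain S where S: "S \<subseteq> K - {u}" "card S = k"
    by (meson obtain_subset_with_card_n)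
  have "upward_star G u S"
    unfolding upward_star_def
  proof (intro ballI conjI)
    fix v assume "v \<in> S"
    then have v: "v \<in> K" "v \<noteq> u"
      using S by auto
    then show "fst G u \<le> fst G v"
      using u by blast
    have "{u, v} \<in> edges G"
      using clique(2) u v by (auto simp: clique_def)
    then show "close G u v"
      by (simp add: edge_iff_close)
  qed
  then show thesis
    using that[of u S] u S clique(1) by auto
qed

lemma clique_number_greater_imp_upward_star:
  assumes "k < clique_number {..<n} (edges G)"
  obtains u S where "u < n" "S \<subseteq> {..<n} - {u}" "card S = k" "upward_star G u S"
proof -
  obtain K where "K \<subseteq> {..<n}" "clique K (edges G)" "card K > k"
    using assms clique_number_le_iff[OF finite_lessThan, of n "edges G" k] by (auto simp: not_le)
  then show thesis
    using clique_imp_upward_star that by blast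
qed

lemma measurable_weight:
  assumes "v < n"
  shows "(\<lambda>G. fst G v) \<in> borel_measurable \<G>"
proof -
  have "(\<lambda>w. w v) \<in> borel_measurable (PiM {..<n} (\<lambda>_. \<W>))"
    using measurable_component_singleton[of v "{..<n}" "\<lambda>_. \<W>"] assms
    by (simp cong: measurable_cong_sets)
  then show ?thesis
    unfolding girg_measure_def by (rule measurable_compose[OF measurable_fst])
qed

lemma measurable_position:
  assumes "v < n"
  shows "(\<lambda>G. snd G v) \<in> measurable \<G> \<T>"
  unfolding girg_measure_def using assms
  by (intro measurable_compose[OF measurable_snd measurable_component_singleton]) simp

lemma pred_close:
  assumes "u < n" "v < n"
  shows "Measurable.pred \<G> (\<lambda>G. close G u v)"
proof -
  note [measurable] = assms[THEN measurable_weight]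
  have [measurable]: "(\<lambda>G. torus_dist d (snd G u) (snd G v)) \<in> borel_measurable \<G>"
    using assms by (intro measurable_torus_dist measurable_position)
  show ?thesis
    unfolding close_def by measurable
qed

lemma pred_upward_star:
  assumes "u < n" "S \<subseteq> {..<n}"
  shows "Measurable.pred \<G> (\<lambda>G. upward_star G u S)"
  unfolding upward_star_def
proof (intro pred_intros_finite pred_intros_logic)
  show "finite S"
    using assms finite_subset by blast
  fix v assume "v \<in> S"
  then have v: "v < n"
    using assms by auto
  note [measurable] = measurable_weight[OF assms(1)] measurable_weight[OF v]
  show "Measurable.pred \<G> (\<lambda>G. fst G u \<le> fst G v)"
    by measurable
  show "Measurable.pred \<G> (\<lambda>G. close G u v)"
    using assms(1) v by (rule pred_close)
qed

lemma pred_clique: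
  assumes "K \<subseteq> {..<n}"
  shows "Measurable.pred \<G> (\<lambda>G. clique K (edges G))"
proof -
  have "{u, v} \<in> edges G \<longleftrightarrow> u \<noteq> v \<and> close G u v" if "u \<in> K" "v \<in> K" for u v G
    using assms that by (subst edge_iff_close) blast
  then have clique_iff: "clique K (edges G) \<longleftrightarrow> (\<forall>u\<in>K. \<forall>v\<in>K. u \<noteq> v \<longrightarrow> close G u v)" for G
    unfolding clique_def by blast
  show ?thesis
    unfolding clique_iff using assms finite_subset[OF assms]
    by (intro pred_intros_finite pred_intros_imp' pred_close) auto
qed

lemma pred_clique_number_le: "Measurable.pred \<G> (\<lambda>G. clique_number {..<n} (edges G) \<le> k)"
  unfolding clique_number_le_iff[OF finite_lessThan]
  by (intro pred_intros_finite pred_intros_logic pred_clique) auto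

end

subsection \<open>Probability of a large clique\<close>

lemma binomial_mult_power_le_exp:
  fixes x :: real
  assumes "x \<ge> 0"
  shows "real (n choose k) * x ^ k \<le> exp (real n * x)"
proof (cases "k \<le> n")
  case True
  have "real (n choose k) * x ^ k \<le> (\<Sum>j\<le>n. real (n choose j) * x ^ j)"
    using True assms by (intro member_le_sum) auto
  also have "\<dots> = (1 + x) ^ n"
    using binomial_ring[of x 1 n] by (simp add: add.commute)
  also have "\<dots> \<le> exp x ^ n"
    using assms by (intro power_mono) auto
  also have "\<dots> = exp (real n * x)"
    by (simp add: exp_of_nat_mult)
  finally show ?thesis .
qed (simp add: binomial_eq_0)

definition clique_constant :: "real \<Rightarrow> real \<Rightarrow> real \<Rightarrow> real" where
  "clique_constant lam w0 \<beta> = exp 1 * (2 * (lam * w0\<^sup>2) powr ((\<beta> - 1) / 2)) + 1"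

lemma clique_constant_pos: "clique_constant lam w0 \<beta> > 0"
  by (simp add: clique_constant_def add_nonneg_pos)

context girg
begin

lemma emeasure_positions_close_le:
  assumes u: "u < n" and S: "S \<subseteq> {..<n} - {u}" and w: "\<And>v. v < n \<Longrightarrow> w v \<ge> 0"
  shows "emeasure (PiM {..<n} (\<lambda>_. \<T>)) {x \<in> space (PiM {..<n} (\<lambda>_. \<T>)). \<forall>v\<in>S. close (w, x) u v}
    \<le> (\<Prod>v\<in>S. ennreal (min 1 (lam * w u * w v / real n)))"
  unfolding close_def fst_conv snd_conv
proof (rule product_prob_space.emeasure_PiM_star_le[OF product_prob_space_positions])
  have [measurable]: "(\<lambda>p. torus_dist d (fst p) (snd p)) \<in> borel_measurable (\<T> \<Otimes>\<^sub>M \<T>)"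
    by (intro measurable_torus_dist) auto
  show "Measurable.pred (\<T> \<Otimes>\<^sub>M \<T>)
      (\<lambda>(a, b). torus_dist d a b \<le> 1 / 2 * (lam * w u * w v / real n) powr (1 / real d))" for v
    unfolding case_prod_beta' by measurable
  show "AE a in \<T>. \<forall>v\<in>S. emeasure \<T> {b \<in> space \<T>.
      torus_dist d a b \<le> 1 / 2 * (lam * w u * w v / real n) powr (1 / real d)}
        \<le> ennreal (min 1 (lam * w u * w v / real n))"
    using AE_torus_uniform
  proof eventually_elim
    case (elim a)
    have "lam * w u * w v / real n \<ge> 0" if "v \<in> S" for v
      using w[OF u] w[of v] that S lam_pos by auto
    then show ?case
      using elim d_pos by (intro ballI emeasure_torus_ball_of_volume_le)
  qed
qed (use u S in auto)

definition upward_link :: "real \<Rightarrow> real \<Rightarrow> ennreal" where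
  "upward_link a b = ennreal (min 1 (lam * a * b / real n)) * indicator {a..} b"

lemma emeasure_upward_star_given_weights_le:
  assumes u: "u < n" and S: "S \<subseteq> {..<n} - {u}"
    and w: "w \<in> space (PiM {..<n} (\<lambda>_. \<W>))" "\<And>v. v < n \<Longrightarrow> w v \<ge> 0"
  shows "emeasure (PiM {..<n} (\<lambda>_. \<T>)) (Pair w -` {G \<in> space \<G>. upward_star G u S})
    \<le> (\<Prod>v\<in>S. upward_link (w u) (w v))"
proof (cases "\<forall>v\<in>S. w u \<le> w v")
  case True
  then have "Pair w -` {G \<in> space \<G>. upward_star G u S} =
      {x \<in> space (PiM {..<n} (\<lambda>_. \<T>)). \<forall>v\<in>S. close (w, x) u v}"
    using w(1) by (auto simp: girg_measure_def space_pair_measure upward_star_def)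
  then show ?thesis
    using emeasure_positions_close_le[OF u S, of w] w(2) True by (simp add: upward_link_def)
next
  case False
  then have "Pair w -` {G \<in> space \<G>. upward_star G u S} = {}"
    by (auto simp: upward_star_def)
  then show ?thesis
    by (simp only: emeasure_empty zero_le)
qed

lemma measurable_upward_link: "case_prod upward_link \<in> borel_measurable (\<W> \<Otimes>\<^sub>M \<W>)"
proof -
  have "case_prod upward_link =
      (\<lambda>p. ennreal (min 1 (lam * fst p * snd p / real n)) * (if fst p \<le> snd p then 1 else 0))"
    by (auto simp: upward_link_def indicator_def)
  moreover have "\<dots> \<in> borel_measurable (borel \<Otimes>\<^sub>M borel)"
    by measurable
  ultimately show ?thesis
    by (simp cong: measurable_cong_sets sets_pair_measure_cong)
qed

lemma emeasure_upward_star_le_nn_integral: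
  assumes u: "u < n" and S: "S \<subseteq> {..<n} - {u}"
  shows "emeasure \<G> {G \<in> space \<G>. upward_star G u S}
    \<le> (\<integral>\<^sup>+w. (\<Prod>v\<in>S. upward_link (w u) (w v)) \<partial>PiM {..<n} (\<lambda>_. \<W>))"
proof -
  interpret weights: product_prob_space "\<lambda>_. \<W>" "{..<n}"
    by (rule product_prob_space_weights)
  interpret positions: product_prob_space "\<lambda>_. \<T>" "{..<n}"
    by (rule product_prob_space_positions)
  let ?weights = "PiM {..<n} (\<lambda>_. \<W>)" and ?positions = "PiM {..<n} (\<lambda>_. \<T>)"
  let ?E = "{G \<in> space \<G>. upward_star G u S}"
  have "S \<subseteq> {..<n}"
    using S by blast
  from pred_upward_star[OF u this] have "?E \<in> sets (?weights \<Otimes>\<^sub>M ?positions)"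
    by (simp add: pred_def girg_measure_def)
  then have "emeasure \<G> ?E = (\<integral>\<^sup>+w. emeasure ?positions (Pair w -` ?E) \<partial>?weights)"
    unfolding girg_measure_def by (rule positions.P.emeasure_pair_measure_alt)
  also have "\<dots> \<le> (\<integral>\<^sup>+w. (\<Prod>v\<in>S. upward_link (w u) (w v)) \<partial>?weights)"
  proof (rule nn_integral_mono_AE)
    have "AE w in ?weights. \<forall>v\<in>{..<n}. w v > w0"
      using w0_pos \<beta>_bounds
      by (intro AE_finite_allI AE_PiM_component AE_weight_greater weights.prob_space) auto
    then show "AE w in ?weights.
        emeasure ?positions (Pair w -` ?E) \<le> (\<Prod>v\<in>S. upward_link (w u) (w v))"
      using AE_space
    proof eventually_elim
      case (elim w)
      then show ?case
        using w0_pos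
        by (intro emeasure_upward_star_given_weights_le[OF u S])
          (auto intro: less_imp_le less_trans)
    qed
  qed
  finally show ?thesis .
qed

definition upward_link_bound :: real where
  "upward_link_bound = 2 * (lam * w0\<^sup>2 / real n) powr ((\<beta> - 1) / 2)"

lemma upward_link_bound_nonneg: "upward_link_bound \<ge> 0"
  by (simp add: upward_link_bound_def)

lemma nn_integral_upward_link_le:
  assumes "a > 0"
  shows "(\<integral>\<^sup>+b. upward_link a b \<partial>\<W>) \<le> ennreal upward_link_bound"
  using nn_integral_weight_min_one_le[OF w0_pos \<beta>_bounds assms, of "lam / real n"] lam_pos
  by (simp add: upward_link_def upward_link_bound_def)

lemma prob_upward_star_le:
  assumes u: "u < n" and S: "S \<subseteq> {..<n} - {u}"
  shows "\<P>(G in \<G>. upward_star G u S) \<le> upward_link_bound ^ card S"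
proof -
  have "emeasure \<G> {G \<in> space \<G>. upward_star G u S}
      \<le> (\<integral>\<^sup>+w. (\<Prod>v\<in>S. upward_link (w u) (w v)) \<partial>PiM {..<n} (\<lambda>_. \<W>))"
    using u S by (rule emeasure_upward_star_le_nn_integral)
  also have "\<dots> \<le> (\<Prod>v\<in>S. ennreal upward_link_bound)"
  proof (rule product_prob_space.nn_integral_PiM_star_le[OF product_prob_space_weights])
    show "AE a in \<W>. \<forall>v\<in>S. (\<integral>\<^sup>+b. upward_link a b \<partial>\<W>) \<le> ennreal upward_link_bound"
      using AE_weight_greater[OF w0_pos \<beta>_bounds(1)]
      by eventually_elim (use w0_pos in \<open>auto intro!: nn_integral_upward_link_le\<close>)
  qed (use u S measurable_upward_link in auto)
  also have "\<dots> = ennreal (upward_link_bound ^ card S)"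
    using upward_link_bound_nonneg by (simp add: ennreal_power)
  finally show ?thesis
    using upward_link_bound_nonneg by (simp add: emeasure_eq_measure)
qed

definition candidate_stars :: "nat \<Rightarrow> (nat \<times> nat set) set" where
  "candidate_stars k = (SIGMA u:{..<n}. {S. S \<subseteq> {..<n} - {u} \<and> card S = k})"

lemma finite_candidate_stars: "finite (candidate_stars k)"
  unfolding candidate_stars_def by (intro finite_SigmaI) auto

lemma card_candidate_stars_le: "card (candidate_stars k) \<le> n * (n choose k)"
proof -
  have "card (candidate_stars k) = n * (n - 1 choose k)"
    unfolding candidate_stars_def by (subst card_SigmaI) (auto simp: n_subsets)
  then show ?thesis
    by (simp add: binomial_right_mono)
qed

lemma prob_clique_number_greater_le:
  "\<P>(G in \<G>. k < clique_number {..<n} (edges G))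
    \<le> real n * (real (n choose k) * upward_link_bound ^ k)"
proof -
  define star_event where "star_event = (\<lambda>(u, S). {G \<in> space \<G>. upward_star G u S})"
  have star_event_sets: "star_event ` candidate_stars k \<subseteq> events"
  proof
    fix E assume "E \<in> star_event ` candidate_stars k"
    then obtain u S where uS: "u < n" "S \<subseteq> {..<n}" "E = {G \<in> space \<G>. upward_star G u S}"
      by (auto simp: star_event_def candidate_stars_def)
    then show "E \<in> events"
      using pred_upward_star[OF uS(1,2)] by (simp add: pred_def)
  qed
  have "\<P>(G in \<G>. k < clique_number {..<n} (edges G)) \<le> prob (\<Union>i\<in>candidate_stars k. star_event i)"
  proof (rule finite_measure_mono)
    show "(\<Union>i\<in>candidate_stars k. star_event i) \<in> events"
      using star_event_sets finite_candidate_stars by (intro sets.finite_UN) auto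
    show "{G \<in> space \<G>. k < clique_number {..<n} (edges G)} \<subseteq> (\<Union>i\<in>candidate_stars k. star_event i)"
      by (auto simp: candidate_stars_def star_event_def
          elim!: clique_number_greater_imp_upward_star)
  qed
  also have "\<dots> \<le> (\<Sum>i\<in>candidate_stars k. prob (star_event i))"
    by (rule finite_measure_subadditive_finite[OF finite_candidate_stars star_event_sets])
  also have "\<dots> \<le> real (card (candidate_stars k)) * upward_link_bound ^ k"
  proof (rule sum_bounded_above)
    fix i assume "i \<in> candidate_stars k"
    then obtain u S where i: "i = (u, S)" "u < n" "S \<subseteq> {..<n} - {u}" "card S = k"
      by (auto simp: candidate_stars_def)
    show "prob (star_event i) \<le> upward_link_bound ^ k"
      using prob_upward_star_le[OF i(2,3)] by (simp add: star_event_def i(1,4))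
  qed
  also have "\<dots> \<le> real (n * (n choose k)) * upward_link_bound ^ k"
    using card_candidate_stars_le upward_link_bound_nonneg
    by (intro mult_right_mono of_nat_mono) auto
  finally show ?thesis
    by simp
qed

lemma prob_clique_number_le_ge:
  assumes "c \<ge> 0"
  shows "\<P>(G in \<G>. real (clique_number {..<n} (edges G)) \<le> c)
    \<ge> 1 - real n * exp (exp 1 * real n * upward_link_bound + 1 - c)"
proof -
  define k where "k = nat \<lfloor>c\<rfloor>"
  have le_c_iff: "real m \<le> c \<longleftrightarrow> m \<le> k" for m
    unfolding k_def using assms by linarith
  have "real (n choose k) * upward_link_bound ^ k =
      real (n choose k) * (exp 1 * upward_link_bound) ^ k * exp (- real k)"
    by (simp add: power_mult_distrib exp_minus flip: exp_of_nat_mult)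
  also have "\<dots> \<le> exp (real n * (exp 1 * upward_link_bound)) * exp (- real k)"
    using upward_link_bound_nonneg by (intro mult_right_mono binomial_mult_power_le_exp) auto
  also have "\<dots> \<le> exp (exp 1 * real n * upward_link_bound + 1 - c)"
    using le_c_iff[of "Suc k"] by (simp add: mult_ac flip: exp_add)
  finally have "\<P>(G in \<G>. k < clique_number {..<n} (edges G))
      \<le> real n * exp (exp 1 * real n * upward_link_bound + 1 - c)"
    by (intro order_trans[OF prob_clique_number_greater_le] mult_left_mono) auto
  then show ?thesis
    using prob_neg[of "\<lambda>G. clique_number {..<n} (edges G) \<le> k"] pred_clique_number_le[of k]
    by (simp add: le_c_iff pred_def not_le)
qed

lemma mult_upward_link_bound:
  "real n * upward_link_bound = 2 * (lam * w0\<^sup>2) powr ((\<beta> - 1) / 2) * real n powr ((3 - \<beta>) / 2)"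
proof (cases "n = 0")
  case False
  have "(3 - \<beta>) / 2 = 1 - (\<beta> - 1) / 2"
    by (simp add: field_simps)
  then have "real n powr ((3 - \<beta>) / 2) = real n / real n powr ((\<beta> - 1) / 2)"
    using False by (simp only: powr_diff) simp
  then show ?thesis
    by (simp add: upward_link_bound_def powr_divide)
qed simp

lemma prob_clique_number_le_powr_ge:
  "\<P>(G in \<G>. real (clique_number {..<n} (edges G))
      \<le> clique_constant lam w0 \<beta> * real n powr ((3 - \<beta>) / 2))
    \<ge> 1 - real n * exp (1 - real n powr ((3 - \<beta>) / 2))"
proof -
  let ?c = "clique_constant lam w0 \<beta> * real n powr ((3 - \<beta>) / 2)"
  have exponent: "exp 1 * real n * upward_link_bound + 1 - ?c = 1 - real n powr ((3 - \<beta>) / 2)"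
    unfolding mult.assoc mult_upward_link_bound by (simp add: clique_constant_def algebra_simps)
  have "?c \<ge> 0"
    using clique_constant_pos[of lam w0 \<beta>] by simp
  from prob_clique_number_le_ge[OF this] show ?thesis
    unfolding exponent .
qed

end

theorem theorem15:
  fixes lam w0 \<beta> :: real and d :: "nat \<Rightarrow> nat"
  assumes "lam > 0" and "w0 > 0" and "\<beta> > 2" and "\<beta> < 3"
    and "\<And>n. d n \<ge> 1"
  shows "\<exists>C>0. (\<lambda>n. \<P>(G in girg_measure n \<beta> w0 (d n).
            real (clique_number {..<n} (girg_edges lam n (d n) G)) \<le> C * real n powr ((3 - \<beta>) / 2)))
          \<longlonglongrightarrow> 1"
proof -
  define \<gamma> where "\<gamma> = (3 - \<beta>) / 2"
  define p where "p n = \<P>(G in girg_measure n \<beta> w0 (d n).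
    real (clique_number {..<n} (girg_edges lam n (d n) G))
      \<le> clique_constant lam w0 \<beta> * real n powr \<gamma>)" for n
  have bounds: "1 - real n * exp (1 - real n powr \<gamma>) \<le> p n" "p n \<le> 1" for n
  proof -
    interpret girg lam w0 \<beta> n "d n"
      using assms by unfold_locales auto
    show "1 - real n * exp (1 - real n powr \<gamma>) \<le> p n"
      unfolding p_def \<gamma>_def by (rule prob_clique_number_le_powr_ge)
    show "p n \<le> 1"
      unfolding p_def by (rule prob_le_1)
  qed
  have "(\<lambda>n. 1 - real n * exp (1 - real n powr \<gamma>)) \<longlonglongrightarrow> 1"
    using assms(4) unfolding \<gamma>_def by real_asymp
  then have "p \<longlonglongrightarrow> 1"
    by (rule tendsto_sandwich[OF _ _ _ tendsto_const, rotated 2]) (use bounds in auto)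
  then show ?thesis
    using clique_constant_pos unfolding p_def \<gamma>_def by blast
qed

end
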